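(* Let $K\subset\mathbb{R}^d$ be a convex body. Then $$\frac{r_1(K,\mathbb{B}_2)}{r(K,\mathbb{B}_2)} \le \begin{cases} \min\left\{\sqrt{d},\ \frac{s(K)+1}{2}\right\} & \text{if } d \text{ is odd},\\[2mm] \min\left\{\frac{d+1}{\sqrt{d+2}},\ \frac{s(K)+1}{2}\right\} & \text{if } d \text{ is even}.\end{cases}$$ This bound is best possible in the sense that for every $\sigma\in[1,d]$ there is a convex body $K\subset\mathbb{R}^d$ with $s(K)=\sigma$ for which the inequality is tight (holds with equality).
   Context: A convex body in $\mathbb{R}^d$ is a non-empty compact convex set. $\mathbb{B}_2=\{x\in\mathbb{R}^d:\|x\|_2\le 1\}$ is the Euclidean unit ball. For a convex body $K$: - $r(K,\mathbb{B}_2) := \sup\{\rho\ge 0 : \exists c\in\mathbb{R}^d \text{ such that } c+\rho\mathbb{B}_2\subset K\}$ (Euclidean inradius). - $r_1(K,\mathbb{B}_2) := \inf\left\{\frac{h(K-K,a)}{h(\mathbb{B}_2-\mathbb{B}_2,a)} : a\in\mathbb{R}^d\setminus\{0\}\right\}$ (half the minimal Euclidean width), where $h(A,a)=\sup\{a^Tx:x\in A\}$ and $A-A=\{x-y:x,y\in A\}$. - Minkowski asymmetry: $s(K) := \inf\{\rho\ge 0:\exists c\in\mathbb{R}^d \text{ such that } -K\subset c+\rho K\}$, where $-K=\{-x:x\in K\}$. Convention: ratios of the form $0/0$ or $\infty/\infty$ are taken to be $1$.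
   Formalization: The inequality is stated for convex bodies K that are not a single point: for K={p} the definition gives s(K)=0, so the bound is at most 1/2, while the ratio is 0/0=1 by convention, and the claim fails. *)

theory Defs
  imports "HOL-Analysis.Analysis"
begin

definition convex_body :: "(real ^ 'n) set \<Rightarrow> bool" where
  "convex_body K \<longleftrightarrow> K \<noteq> {} \<and> compact K \<and> convex K"

definition unit_ball :: "(real ^ 'n) set" where
  "unit_ball = {x. norm x \<le> 1}"

definition support_fun :: "(real ^ 'n) set \<Rightarrow> real ^ 'n \<Rightarrow> real" where
  "support_fun A a = (SUP x\<in>A. a \<bullet> x)"

definition difference_body :: "(real ^ 'n) set \<Rightarrow> (real ^ 'n) set" where
  "difference_body A = {x - y | x y. x \<in> A \<and> y \<in> A}"

definition inradius :: "(real ^ 'n) set \<Rightarrow> real" where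
  "inradius K = Sup {\<rho>. \<rho> \<ge> 0 \<and> (\<exists>c. {c + \<rho> *\<^sub>R x | x. x \<in> unit_ball} \<subseteq> K)}"

text \<open>Half the minimal width. No convention for \<open>0/0\<close> is needed here, as the denominator
  equals \<open>2 * norm a > 0\<close>.\<close>

definition half_width :: "(real ^ 'n) set \<Rightarrow> real" where
  "half_width K =
     Inf {support_fun (difference_body K) a / support_fun (difference_body unit_ball) a | a. a \<noteq> 0}"

definition minkowski_asymmetry :: "(real ^ 'n) set \<Rightarrow> real" where
  "minkowski_asymmetry K =
     Inf {\<rho>. \<rho> \<ge> 0 \<and> (\<exists>c. {- x | x. x \<in> K} \<subseteq> {c + \<rho> *\<^sub>R x | x. x \<in> K})}"

text \<open>The convention \<open>0/0 = 1\<close>. For \<open>x = half_width K\<close> and \<open>y = inradius K\<close> with \<open>K\<close> a convex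
  body, \<open>y = 0\<close> forces \<open>x = 0\<close> (\<open>K\<close> then lies in a hyperplane), so the value of
  \<open>x / 0\<close> for \<open>x \<noteq> 0\<close> is irrelevant.\<close>

definition ratio :: "real \<Rightarrow> real \<Rightarrow> real" where
  "ratio x y = (if x = 0 \<and> y = 0 then 1 else x / y)"

definition ratio_bound :: "nat \<Rightarrow> real \<Rightarrow> real" where
  "ratio_bound d s =
     (if odd d then min (sqrt (real d)) ((s + 1) / 2)
      else min ((real d + 1) / sqrt (real d + 2)) ((s + 1) / 2))"

text \<open>For a single point the infimum defining the asymmetry is \<open>0\<close>, whereas it is at least \<open>1\<close>
  for every other convex body. Hence the bound on the ratio, which is \<open>0/0 = 1\<close> for a point,
  has to be restricted to convex bodies with more than one point.\<close>

lemma minkowski_asymmetry_singleton: "minkowski_asymmetry {p} = 0"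
proof -
  have "{\<rho>. \<rho> \<ge> 0 \<and> (\<exists>c. {- x | x. x \<in> {p}} \<subseteq> {c + \<rho> *\<^sub>R x | x. x \<in> {p}})} = {0..}"
    by (auto intro!: exI[of _ "- p - _ *\<^sub>R p"])
  then show ?thesis by (simp add: minkowski_asymmetry_def)
qed

end

theory Submission
  imports Defs
begin

text \<open>
  Write \<open>w\<close> for the half width, \<open>r\<close> for the inradius and \<open>d\<close> for the dimension. The upper bound has
  two independent parts.

  The bound by \<open>(s(K) + 1) / 2\<close> compares \<open>K\<close> with its difference body. By separation, \<open>K - K\<close>
  contains the centred ball of radius \<open>2 w\<close>. If \<open>- K\<close> lies in a translate of \<open>\<rho> K\<close>, then
  \<open>K - K\<close> lies in a translate of \<open>(\<rho> + 1) K\<close>, so \<open>K\<close> contains a ball of radius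
  \<open>2 w / (\<rho> + 1)\<close> (\<open>half_width_le_factor_inradius\<close>).

  The bound depending on \<open>d\<close> alone is Steinhagen's theorem. An inscribed ball of maximal radius cannot
  be moved and enlarged, so the origin is a convex combination of the outer normals at its contact
  points (\<open>zero_in_hull_contact_normals\<close>), and of at most \<open>d + 1\<close> of them by Caratheodory. Splitting
  the weighted normals into two groups, whose sums are \<open>a\<close> and \<open>- a\<close>, shows that the extent of \<open>K\<close>
  along \<open>a\<close> is at most \<open>r\<close>, so \<open>2 w norm a \<le> r\<close>. An exchange argument finds a group with a long
  sum (\<open>balanced_subset_sum\<close>); groups of equal size are best, and the parity of \<open>d + 1\<close> decides
  whether these exist, whence the two cases.

  For the sharpness let \<open>S\<close> be a regular simplex with inradius \<open>1\<close> around the origin and take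
  \<open>K = S \<inter> - \<sigma> S\<close>. Its inradius is \<open>1\<close> and its asymmetry is \<open>\<sigma>\<close>. In coordinates given by the
  facet normals, membership of \<open>x\<close> in \<open>K - K\<close> asks for reals with sum \<open>0\<close> in prescribed intervals;
  this is solvable as soon as \<open>norm x\<close> is at most twice the claimed bound
  (\<open>cball_subset_difference_truncated_simplex\<close>), so the half width is at least that bound.
\<close>

section \<open>Width and difference body\<close>

lemma support_fun_difference_body_le:
  assumes "convex_body K" and "\<And>x y. x \<in> K \<Longrightarrow> y \<in> K \<Longrightarrow> a \<bullet> x - a \<bullet> y \<le> w"
  shows "support_fun (difference_body K) a \<le> w"
  unfolding support_fun_def
proof (rule cSUP_least)
  show "difference_body K \<noteq> {}"
    using assms(1) by (auto simp: convex_body_def difference_body_def)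
qed (use assms(2) in \<open>auto simp: difference_body_def inner_diff_right\<close>)

lemma convex_body_difference_body:
  assumes "convex_body K"
  shows "convex_body (difference_body K)"
proof -
  have "(\<Union>x\<in>K. \<Union>y\<in>K. {x - y}) = difference_body K"
    by (auto simp: difference_body_def)
  then show ?thesis
    using assms convex_differences[of K K] compact_differences'[of K K]
    by (auto simp: convex_body_def)
qed

lemma inner_le_support_fun:
  assumes "convex_body K" "x \<in> K"
  shows "a \<bullet> x \<le> support_fun K a"
  unfolding support_fun_def
proof (rule cSUP_upper[OF assms(2)])
  have "compact ((\<bullet>) a ` K)"
    using assms(1) by (intro compact_continuous_image continuous_intros) (auto simp: convex_body_def)
  then show "bdd_above ((\<bullet>) a ` K)"
    by (intro bounded_imp_bdd_above compact_imp_bounded)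
qed

lemma unit_ball_eq_cball: "unit_ball = cball 0 1"
  by (auto simp: unit_ball_def)

lemma convex_body_unit_ball: "convex_body unit_ball"
  by (simp add: convex_body_def unit_ball_eq_cball)

lemma support_fun_difference_unit_ball:
  "support_fun (difference_body (unit_ball :: (real ^ 'n) set)) a = 2 * norm a"
proof (rule antisym)
  show "support_fun (difference_body (unit_ball :: (real ^ 'n) set)) a \<le> 2 * norm a"
  proof (rule support_fun_difference_body_le[OF convex_body_unit_ball])
    fix x y :: "real ^ 'n"
    assume xy: "x \<in> unit_ball" "y \<in> unit_ball"
    then have "norm (x - y) \<le> 2"
      using norm_triangle_ineq4[of x y] by (simp add: unit_ball_def)
    then have "norm a * norm (x - y) \<le> norm a * 2"
      by (intro mult_left_mono) auto
    then show "a \<bullet> x - a \<bullet> y \<le> 2 * norm a"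
      using norm_cauchy_schwarz[of a "x - y"] by (simp add: inner_diff_right)
  qed
  let ?u = "sgn a"
  have "?u - (- ?u) \<in> difference_body unit_ball"
    unfolding difference_body_def unit_ball_def
    by (intro CollectI exI[of _ ?u] exI[of _ "- ?u"]) (simp add: norm_sgn)
  from inner_le_support_fun[OF convex_body_difference_body[OF convex_body_unit_ball] this, of a]
  have "a \<bullet> (?u + ?u) \<le> support_fun (difference_body (unit_ball :: (real ^ 'n) set)) a" by simp
  moreover have "a \<bullet> ?u = norm a"
    by (cases "a = 0") (simp_all add: sgn_div_norm power2_norm_eq_inner[symmetric] power2_eq_square)
  ultimately show "2 * norm a \<le> support_fun (difference_body (unit_ball :: (real ^ 'n) set)) a"
    unfolding inner_add_right by linarith
qed

lemma half_width_eq: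
  "half_width K = Inf {support_fun (difference_body K) a / (2 * norm a) | a. a \<noteq> 0}"
  by (simp add: half_width_def support_fun_difference_unit_ball)

lemma support_fun_difference_body_nonneg:
  assumes "convex_body K"
  shows "0 \<le> support_fun (difference_body K) a"
proof -
  obtain x where "x \<in> K" using assms by (auto simp: convex_body_def)
  then have "0 \<in> difference_body K" by (force simp: difference_body_def)
  from inner_le_support_fun[OF convex_body_difference_body[OF assms] this, of a]
  show ?thesis by simp
qed

text \<open>Upper bounds on the half width come from exhibiting one direction \<open>a\<close> in which the body has
  small extent.\<close>

lemma half_width_times_norm_le:
  fixes K :: "(real ^ 'n) set"
  assumes K: "convex_body K" and "a \<noteq> 0"
    and w: "\<And>x y. x \<in> K \<Longrightarrow> y \<in> K \<Longrightarrow> a \<bullet> x - a \<bullet> y \<le> w"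
  shows "half_width K * (2 * norm a) \<le> w"
proof -
  have "bdd_below {support_fun (difference_body K) a / (2 * norm a) | a. a \<noteq> 0}"
    by (intro bdd_belowI[of _ 0]) (auto simp: support_fun_difference_body_nonneg[OF K])
  then have "half_width K \<le> support_fun (difference_body K) a / (2 * norm a)"
    unfolding half_width_eq using \<open>a \<noteq> 0\<close> by (intro cInf_lower) auto
  then have "half_width K * (2 * norm a) \<le> support_fun (difference_body K) a"
    using \<open>a \<noteq> 0\<close> by (simp add: pos_le_divide_eq)
  also have "\<dots> \<le> w" using support_fun_difference_body_le[OF K w] .
  finally show ?thesis .
qed

lemma ex_nonzero_vec: "\<exists>a :: real ^ 'n. a \<noteq> 0"
  by (rule exI[of _ "axis undefined 1"]) (simp add: axis_eq_0_iff)

text \<open>The half width is the radius of the largest centred ball in \<open>K - K\<close>: this lemma and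
  \<open>cball_half_width_subset\<close> give the two halves of that fact.\<close>

lemma half_width_ge:
  fixes K :: "(real ^ 'n) set"
  assumes K: "convex_body K" and "0 \<le> \<rho>" and sub: "cball 0 (2 * \<rho>) \<subseteq> difference_body K"
  shows "\<rho> \<le> half_width K"
  unfolding half_width_eq
proof (rule cInf_greatest)
  show "{support_fun (difference_body K) a / (2 * norm a) | a. a \<noteq> 0} \<noteq> {}"
    using ex_nonzero_vec by auto
  fix q assume "q \<in> {support_fun (difference_body K) a / (2 * norm a) | a. a \<noteq> 0}"
  then obtain a :: "real ^ 'n" where a: "a \<noteq> 0"
    and q: "q = support_fun (difference_body K) a / (2 * norm a)" by auto
  have "(2 * \<rho>) *\<^sub>R sgn a \<in> difference_body K"
    using sub a \<open>0 \<le> \<rho>\<close> by (auto simp: norm_sgn)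
  from inner_le_support_fun[OF convex_body_difference_body[OF K] this, of a]
  moreover have "a \<bullet> sgn a = norm a"
    using a by (simp add: sgn_div_norm power2_norm_eq_inner[symmetric] power2_eq_square)
  ultimately have "2 * \<rho> * norm a \<le> support_fun (difference_body K) a" by simp
  then show "\<rho> \<le> q" using a by (simp add: q pos_le_divide_eq mult_ac)
qed

text \<open>A point \<open>z\<close> outside \<open>K - K\<close> is strictly separated from it by some direction, in which the width
  of \<open>K\<close> is then less than the norm of \<open>z\<close>.\<close>

lemma cball_half_width_subset:
  fixes K :: "(real ^ 'n) set"
  assumes K: "convex_body K"
  shows "cball 0 (2 * half_width K) \<subseteq> difference_body K"
proof
  fix z :: "real ^ 'n" assume z: "z \<in> cball 0 (2 * half_width K)"
  show "z \<in> difference_body K"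
  proof (rule ccontr)
    assume "z \<notin> difference_body K"
    moreover have "convex (difference_body K)" "closed (difference_body K)"
      using convex_body_difference_body[OF K] by (auto simp: convex_body_def compact_imp_closed)
    ultimately obtain a b where a: "a \<bullet> z < b" "\<forall>x\<in>difference_body K. a \<bullet> x > b"
      using separating_hyperplane_closed_point by metis
    have w: "a \<bullet> x - a \<bullet> y \<le> - b" if "x \<in> K" "y \<in> K" for x y
    proof -
      have "y - x \<in> difference_body K" using that by (auto simp: difference_body_def)
      then show ?thesis using a(2) by (force simp: inner_diff_right)
    qed
    obtain p where "p \<in> K" using K by (auto simp: convex_body_def)
    with w[of p p] have "b \<le> 0" by simp
    with a(1) have "a \<noteq> 0" by auto
    have "half_width K * (2 * norm a) \<le> - b"
      using half_width_times_norm_le[OF K \<open>a \<noteq> 0\<close> w] .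
    moreover have "norm a * norm z \<le> norm a * (2 * half_width K)"
      using z by (intro mult_left_mono) auto
    moreover have "- (a \<bullet> z) \<le> norm a * norm z"
      using norm_cauchy_schwarz[of a "- z"] by simp
    ultimately show False using a(1) by (simp add: mult_ac)
  qed
qed

lemma half_width_nonneg:
  fixes K :: "(real ^ 'n) set"
  assumes "convex_body K"
  shows "0 \<le> half_width K"
proof (rule half_width_ge[OF assms])
  obtain p where "p \<in> K" using assms by (auto simp: convex_body_def)
  then show "cball 0 (2 * 0) \<subseteq> difference_body K" by (force simp: difference_body_def)
qed simp

section \<open>The inradius is attained\<close>

lemma scaled_unit_ball_eq_cball:
  assumes "0 \<le> \<rho>"
  shows "{c + \<rho> *\<^sub>R x | x. x \<in> (unit_ball :: (real ^ 'n) set)} = cball c \<rho>"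
proof (intro set_eqI iffI)
  fix y assume "y \<in> cball c \<rho>"
  then have n: "norm (y - c) \<le> \<rho>" by (simp add: dist_norm norm_minus_commute)
  show "y \<in> {c + \<rho> *\<^sub>R x | x. x \<in> unit_ball}"
  proof (cases "\<rho> = 0")
    case True
    then show ?thesis using n by (auto simp: unit_ball_def intro!: exI[of _ 0])
  next
    case False
    then show ?thesis using n assms
      by (intro CollectI exI[of _ "(y - c) /\<^sub>R \<rho>"]) (auto simp: unit_ball_def divide_simps)
  qed
qed (use assms in \<open>auto simp: unit_ball_def dist_norm mult_left_le\<close>)

lemma inradius_eq:
  "inradius K = Sup {\<rho>. 0 \<le> \<rho> \<and> (\<exists>c. cball c \<rho> \<subseteq> K)}"
  unfolding inradius_def by (simp add: scaled_unit_ball_eq_cball cong: conj_cong)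

lemma inradius_ge:
  assumes K: "convex_body K" and "0 \<le> \<rho>" "cball c \<rho> \<subseteq> K"
  shows "\<rho> \<le> inradius K"
  unfolding inradius_eq
proof (rule cSup_upper)
  have "bounded K" using K by (simp add: convex_body_def compact_imp_bounded)
  from bounded_subset_ballD[OF this, of 0] obtain R where R: "K \<subseteq> cball 0 R"
    using ball_subset_cball by blast
  show "bdd_above {\<rho>. 0 \<le> \<rho> \<and> (\<exists>c. cball c \<rho> \<subseteq> K)}"
  proof (rule bdd_aboveI)
    fix t assume "t \<in> {\<rho>. 0 \<le> \<rho> \<and> (\<exists>c. cball c \<rho> \<subseteq> K)}"
    then obtain c where "0 \<le> t" "cball c t \<subseteq> K" by auto
    then have "0 \<le> t" "cball c t \<subseteq> cball 0 R" using R by blast+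
    then show "t \<le> R" unfolding cball_subset_cball_iff using zero_le_dist[of c 0] by linarith
  qed
  show "\<rho> \<in> {\<rho>. 0 \<le> \<rho> \<and> (\<exists>c. cball c \<rho> \<subseteq> K)}" using assms by blast
qed

text \<open>Balls of radius tending to the supremum have centres in the compact set \<open>K\<close>; an accumulation
  point of these centres is the centre of an optimal ball. The radii used are
  \<open>(1 - 1 / (n + 1)) r\<close>, so that the limit ball is covered by points scaled towards its centre.\<close>

lemma inradius_attained:
  fixes K :: "(real ^ 'n) set"
  assumes K: "convex_body K"
  obtains c where "0 \<le> inradius K" "cball c (inradius K) \<subseteq> K"
proof -
  obtain p where p: "p \<in> K" using K by (auto simp: convex_body_def)
  have compact: "compact K" using K by (simp add: convex_body_def)
  let ?r = "inradius K"
  have "0 \<le> ?r" using inradius_ge[OF K, of 0 p] p by auto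
  have "\<exists>c\<in>K. cball c (?r * (1 - 1 / Suc n)) \<subseteq> K" for n
  proof (cases "?r = 0")
    case True
    then show ?thesis using p by auto
  next
    case False
    with \<open>0 \<le> ?r\<close> have "?r * (1 - 1 / Suc n) < ?r"
      by (simp add: field_simps)
    moreover have "0 \<in> {\<rho>. 0 \<le> \<rho> \<and> (\<exists>c. cball c \<rho> \<subseteq> K)}" using p by (auto intro: exI[of _ p])
    ultimately obtain \<rho> where "\<rho> \<in> {\<rho>. 0 \<le> \<rho> \<and> (\<exists>c. cball c \<rho> \<subseteq> K)}" "?r * (1 - 1 / Suc n) < \<rho>"
      unfolding inradius_eq using less_cSupE by (metis (no_types, lifting) empty_iff)
    then obtain c where \<rho>: "0 \<le> \<rho>" "cball c \<rho> \<subseteq> K" "?r * (1 - 1 / Suc n) < \<rho>"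
      by blast
    have "cball c (?r * (1 - 1 / Suc n)) \<subseteq> K"
      by (rule order_trans[OF subset_cball \<rho>(2)]) (rule less_imp_le[OF \<rho>(3)])
    moreover have "c \<in> K" using subsetD[OF \<rho>(2), of c] \<rho>(1) by simp
    ultimately show ?thesis by blast
  qed
  then obtain c where c: "\<And>n. c n \<in> K" "\<And>n. cball (c n) (?r * (1 - 1 / Suc n)) \<subseteq> K"
    by metis
  obtain l f where l: "l \<in> K" "strict_mono f" "(c \<circ> f) \<longlonglongrightarrow> l"
    using compact c(1) unfolding compact_def by meson
  have "cball l ?r \<subseteq> K"
  proof
    fix y assume "y \<in> cball l ?r"
    then have y: "norm (y - l) \<le> ?r" by (simp add: dist_norm norm_minus_commute)
    let ?t = "\<lambda>n. 1 - 1 / real (Suc n)"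
    have "c (f n) + ?t (f n) *\<^sub>R (y - l) \<in> K" for n
    proof -
      have "norm (?t (f n) *\<^sub>R (y - l)) \<le> ?r * ?t (f n)"
        using y by (simp add: mult.commute mult_right_mono)
      then have "c (f n) + ?t (f n) *\<^sub>R (y - l) \<in> cball (c (f n)) (?r * ?t (f n))"
        by (simp add: dist_norm)
      then show ?thesis using c(2) by blast
    qed
    moreover have "(\<lambda>n. c (f n) + ?t (f n) *\<^sub>R (y - l)) \<longlonglongrightarrow> l + (1 - 0) *\<^sub>R (y - l)"
    proof (intro tendsto_intros)
      show "(\<lambda>n. c (f n)) \<longlonglongrightarrow> l" using l(3) by (simp add: o_def)
      show "(\<lambda>n. 1 / real (Suc (f n))) \<longlonglongrightarrow> 0"
        using LIMSEQ_subseq_LIMSEQ[OF LIMSEQ_inverse_real_of_nat l(2)] by (simp add: o_def inverse_eq_divide)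
    qed
    ultimately show "y \<in> K"
      using compact closed_sequentially[of K "\<lambda>n. c (f n) + ?t (f n) *\<^sub>R (y - l)"]
      by (auto simp: compact_imp_closed)
  qed
  then show thesis using \<open>0 \<le> ?r\<close> that by blast
qed

section \<open>Width, inradius and Minkowski asymmetry\<close>

definition asymmetry_factors :: "(real ^ 'n) set \<Rightarrow> real set" where
  "asymmetry_factors K = {\<rho>. \<rho> \<ge> 0 \<and> (\<exists>c. {- x | x. x \<in> K} \<subseteq> {c + \<rho> *\<^sub>R x | x. x \<in> K})}"

lemma asymmetry_factorI:
  assumes "0 \<le> \<rho>" "\<And>x. x \<in> K \<Longrightarrow> \<exists>y\<in>K. - x = c + \<rho> *\<^sub>R y"
  shows "\<rho> \<in> asymmetry_factors K"
proof -
  have "{- x | x. x \<in> K} \<subseteq> {c + \<rho> *\<^sub>R x | x. x \<in> K}" using assms(2) by fastforce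
  then show ?thesis using assms(1) unfolding asymmetry_factors_def by auto
qed

lemma asymmetry_factorD:
  assumes "\<rho> \<in> asymmetry_factors K"
  obtains c where "0 \<le> \<rho>" "\<And>x. x \<in> K \<Longrightarrow> \<exists>y\<in>K. - x = c + \<rho> *\<^sub>R y"
proof -
  obtain c where "0 \<le> \<rho>" "{- x | x. x \<in> K} \<subseteq> {c + \<rho> *\<^sub>R x | x. x \<in> K}"
    using assms unfolding asymmetry_factors_def by auto
  then show thesis using that[of c] by fastforce
qed

text \<open>If \<open>- K\<close> lies in \<open>c + \<rho> K\<close>, then \<open>K - K\<close> lies in \<open>c + (\<rho> + 1) K\<close> by convexity. The centred
  ball of radius twice the half width in \<open>K - K\<close> therefore shrinks, by the factor \<open>\<rho> + 1\<close>, to a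
  ball in \<open>K\<close>.\<close>

lemma half_width_le_factor_inradius:
  fixes K :: "(real ^ 'n) set"
  assumes K: "convex_body K" and \<rho>: "\<rho> \<in> asymmetry_factors K"
  shows "half_width K \<le> (\<rho> + 1) / 2 * inradius K"
proof -
  obtain c where "0 \<le> \<rho>" and c: "\<And>x. x \<in> K \<Longrightarrow> \<exists>y\<in>K. - x = c + \<rho> *\<^sub>R y"
    using asymmetry_factorD[OF \<rho>] by blast
  let ?h = "2 * half_width K" and ?t = "1 / (\<rho> + 1)"
  have "cball (- ?t *\<^sub>R c) (?h * ?t) \<subseteq> K"
  proof
    fix y assume "y \<in> cball (- ?t *\<^sub>R c) (?h * ?t)"
    then have "norm (y + ?t *\<^sub>R c) \<le> ?h * ?t"
      by (simp add: dist_norm norm_minus_commute)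
    then have "(\<rho> + 1) * norm (y + ?t *\<^sub>R c) \<le> (\<rho> + 1) * (?h * ?t)"
      using \<open>0 \<le> \<rho>\<close> by (intro mult_left_mono) auto
    then have "norm ((\<rho> + 1) *\<^sub>R (y + ?t *\<^sub>R c)) \<le> ?h"
      using \<open>0 \<le> \<rho>\<close> by simp
    then have "(\<rho> + 1) *\<^sub>R (y + ?t *\<^sub>R c) \<in> difference_body K"
      using cball_half_width_subset[OF K] by auto
    then obtain p q where pq: "p \<in> K" "q \<in> K" "(\<rho> + 1) *\<^sub>R (y + ?t *\<^sub>R c) = p - q"
      by (auto simp: difference_body_def)
    obtain q' where q': "q' \<in> K" "- q = c + \<rho> *\<^sub>R q'" using c[OF pq(2)] by blast
    have "(\<rho> + 1) *\<^sub>R y + c = p + (c + \<rho> *\<^sub>R q')"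
      using pq(3) q'(2) \<open>0 \<le> \<rho>\<close> by (simp add: scaleR_add_right)
    then have "(\<rho> + 1) *\<^sub>R y = p + \<rho> *\<^sub>R q'" by simp
    then have "?t *\<^sub>R ((\<rho> + 1) *\<^sub>R y) = ?t *\<^sub>R (p + \<rho> *\<^sub>R q')" by simp
    then have "y = ?t *\<^sub>R p + (\<rho> * ?t) *\<^sub>R q'"
      using \<open>0 \<le> \<rho>\<close> by (simp add: scaleR_add_right mult.commute)
    also have "\<dots> \<in> K"
      using K pq(1) q'(1) \<open>0 \<le> \<rho>\<close> unfolding convex_body_def
      by (intro convexD) (auto simp: add_divide_distrib[symmetric])
    finally show "y \<in> K" .
  qed
  then have "?h * ?t \<le> inradius K"
    using half_width_nonneg[OF K] \<open>0 \<le> \<rho>\<close> by (intro inradius_ge[OF K]) auto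
  then show ?thesis using \<open>0 \<le> \<rho>\<close> by (simp add: field_simps)
qed

text \<open>Needed because the infimum of the empty set of reals has no meaning. Around a relative
  interior point \<open>p\<close>, the reflected and shrunk copy \<open>p + (e / D) (p - K)\<close> stays in the affine hull
  and within distance \<open>e\<close> of \<open>p\<close>, hence in \<open>K\<close>; this also covers bodies without interior.\<close>

lemma asymmetry_factors_nonempty:
  assumes K: "convex_body K"
  shows "asymmetry_factors K \<noteq> {}"
proof -
  have "rel_interior K \<noteq> {}"
    using K by (simp add: convex_body_def rel_interior_eq_empty)
  then obtain p e where p: "p \<in> K" "0 < e" "cball p e \<inter> affine hull K \<subseteq> K"
    by (auto simp: mem_rel_interior_cball)
  obtain D where D: "D > 0" "\<And>x. x \<in> K \<Longrightarrow> norm (p - x) \<le> D"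
  proof -
    have "bounded ((\<lambda>x. p - x) ` K)"
      using K by (intro compact_imp_bounded compact_continuous_image continuous_intros)
        (auto simp: convex_body_def)
    then show thesis using that unfolding bounded_pos by auto
  qed
  have "D / e \<in> asymmetry_factors K"
  proof (rule asymmetry_factorI[of _ _ "- p - (D / e) *\<^sub>R p"])
    fix x assume x: "x \<in> K"
    let ?y = "p + (e / D) *\<^sub>R (p - x)"
    have "(e / D) * norm (p - x) \<le> (e / D) * D"
      using D x p(2) by (intro mult_left_mono) auto
    then have "?y \<in> cball p e" using D(1) p(2) by (simp add: dist_norm)
    moreover have "?y = (1 + e / D) *\<^sub>R p + (- (e / D)) *\<^sub>R x"
      by (simp add: algebra_simps)
    then have "?y \<in> affine hull K"
      using hull_inc[OF p(1)] hull_inc[OF x]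
      by (simp only:) (rule mem_affine[OF affine_affine_hull], auto intro: hull_inc)
    ultimately have "?y \<in> K" using p(3) by blast
    moreover have "- x = (- p - (D / e) *\<^sub>R p) + (D / e) *\<^sub>R ?y"
      using D(1) p(2) by (simp add: scaleR_add_right)
    ultimately show "\<exists>y\<in>K. - x = (- p - (D / e) *\<^sub>R p) + (D / e) *\<^sub>R y" by blast
  qed (use D(1) p(2) in simp)
  then show ?thesis by blast
qed

text \<open>\<open>- K\<close> has the diameter of \<open>K\<close>, which must fit into the diameter of \<open>\<rho> K\<close>.\<close>

lemma asymmetry_factor_ge_1:
  assumes K: "convex_body K" and "\<nexists>p. K = {p}" and \<rho>: "\<rho> \<in> asymmetry_factors K"
  shows "1 \<le> \<rho>"
proof -
  obtain c where "0 \<le> \<rho>" and c: "\<And>x. x \<in> K \<Longrightarrow> \<exists>y\<in>K. - x = c + \<rho> *\<^sub>R y"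
    using asymmetry_factorD[OF \<rho>] by blast
  obtain p where p: "p \<in> K" using K by (auto simp: convex_body_def)
  then obtain q where q: "q \<in> K" "q \<noteq> p" using assms(2) by blast
  have bounded: "bounded K" using K by (simp add: convex_body_def compact_imp_bounded)
  have "norm (x - y) \<le> \<rho> * diameter K" if xy: "x \<in> K" "y \<in> K" for x y
  proof -
    obtain x' y' where *: "x' \<in> K" "- x = c + \<rho> *\<^sub>R x'" "y' \<in> K" "- y = c + \<rho> *\<^sub>R y'"
      using c xy by metis
    have "x - y = \<rho> *\<^sub>R (y' - x')"
      using *(2,4) by (metis (no_types, opaque_lifting) add_diff_cancel_left diff_minus_eq_add minus_diff_commute scaleR_right_diff_distrib uminus_add_conv_diff)
    then have "norm (x - y) = \<rho> * norm (y' - x')" using \<open>0 \<le> \<rho>\<close> by simp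
    also have "\<dots> \<le> \<rho> * diameter K"
      using diameter_bounded_bound[OF bounded *(3,1)] \<open>0 \<le> \<rho>\<close>
      by (intro mult_left_mono) (auto simp: dist_norm)
    finally show ?thesis .
  qed
  then have "diameter K \<le> \<rho> * diameter K"
    using p by (intro diameter_le) auto
  moreover have "0 < diameter K"
    using diameter_bounded_bound[OF bounded p q(1)] q(2) by (metis dist_pos_lt order_less_le_trans)
  ultimately show ?thesis by simp
qed

lemma minkowski_asymmetry_ge_1:
  assumes "convex_body K" "\<nexists>p. K = {p}"
  shows "1 \<le> minkowski_asymmetry K"
  using asymmetry_factors_nonempty[OF assms(1)] asymmetry_factor_ge_1[OF assms]
  unfolding minkowski_asymmetry_def asymmetry_factors_def[symmetric]
  by (intro cInf_greatest) auto

lemma half_width_le_asymmetry_inradius: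
  fixes K :: "(real ^ 'n) set"
  assumes K: "convex_body K"
  shows "half_width K \<le> (minkowski_asymmetry K + 1) / 2 * inradius K"
proof (cases "inradius K = 0")
  case True
  then show ?thesis
    using half_width_le_factor_inradius[OF K] asymmetry_factors_nonempty[OF K] by fastforce
next
  case False
  then have r: "0 < inradius K" using inradius_attained[OF K] by force
  have "2 * half_width K / inradius K - 1 \<le> minkowski_asymmetry K"
    unfolding minkowski_asymmetry_def asymmetry_factors_def[symmetric]
    using half_width_le_factor_inradius[OF K] asymmetry_factors_nonempty[OF K] r
    by (intro cInf_greatest) (auto simp: field_simps)
  then show ?thesis using r by (simp add: field_simps)
qed

section \<open>Long partial sums of vectors adding up to zero\<close>

text \<open>Among the \<open>k\<close>-subsets choose \<open>T\<close> with the longest sum \<open>S\<close>. Exchanging \<open>i\<close> in \<open>T\<close> for \<open>j\<close>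
  outside cannot lengthen the sum, and adding up these \<open>k\<^sup>2\<close> inequalities gives the claim, since
  the complement of \<open>T\<close> sums to \<open>- S\<close>.\<close>

lemma balanced_subset_sum_nat:
  fixes v :: "nat \<Rightarrow> 'a::real_inner"
  assumes zero: "(\<Sum>i<2*k. v i) = 0"
  shows "\<exists>T\<subseteq>{..<2*k}. real k * (\<Sum>i<2*k. (norm (v i))\<^sup>2) \<le> (4 * real k - 2) * (norm (sum v T))\<^sup>2"
proof -
  let ?I = "{..<2*k}"
  let ?F = "{T. T \<subseteq> ?I \<and> card T = k}"
  have "finite ?F" by simp
  moreover have "{..<k} \<in> ?F" by auto
  ultimately have "finite ((\<lambda>T. norm (sum v T)) ` ?F)" "(\<lambda>T. norm (sum v T)) ` ?F \<noteq> {}"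
    by blast+
  from Max_in[OF this] Max_ge[OF this(1)] obtain T where T: "T \<in> ?F"
    and max: "\<And>T'. T' \<in> ?F \<Longrightarrow> norm (sum v T') \<le> norm (sum v T)"
    by (smt (verit) imageE imageI)
  define N where "N = ?I - T"
  define S where "S = sum v T"
  have fin: "finite T" "finite N" using T finite_subset unfolding N_def by auto
  have cards: "card T = k" "card N = k"
    using T fin by (auto simp: N_def card_Diff_subset)
  have split: "sum f ?I = sum f T + sum f N" for f :: "nat \<Rightarrow> 'b::ab_group_add"
    using T by (simp add: N_def sum.subset_diff[of T ?I f] add.commute)
  have SN: "sum v N = - S"
    using split[of v] zero by (simp add: S_def eq_neg_iff_add_eq_0 add.commute)
  have swap: "(norm (v i))\<^sup>2 + (norm (v j))\<^sup>2 - 2 * (v i \<bullet> v j) \<le> 2 * (S \<bullet> v i) - 2 * (S \<bullet> v j)"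
    if "i \<in> T" "j \<in> N" for i j
  proof -
    let ?T = "insert j (T - {i})"
    have j: "j \<notin> T" "j \<in> ?I" using that by (auto simp: N_def)
    have "card ?T = k"
      using that j fin cards by (simp add: card_Suc_Diff1)
    then have "?T \<in> ?F" using T j by auto
    from max[OF this] have "norm (sum v ?T) \<le> norm S" by (simp add: S_def)
    moreover have "sum v ?T = S - v i + v j"
      using that j fin by (simp add: S_def sum_diff1)
    ultimately have "(S - v i + v j) \<bullet> (S - v i + v j) \<le> S \<bullet> S"
      by (simp add: norm_le)
    then show ?thesis
      by (simp add: inner_add_left inner_add_right inner_diff_left inner_diff_right
          inner_commute power2_norm_eq_inner)
  qed
  have "(\<Sum>i\<in>T. \<Sum>j\<in>N. (norm (v i))\<^sup>2 + (norm (v j))\<^sup>2 - 2 * (v i \<bullet> v j))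
      \<le> (\<Sum>i\<in>T. \<Sum>j\<in>N. 2 * (S \<bullet> v i) - 2 * (S \<bullet> v j))"
    by (intro sum_mono swap)
  moreover have "(\<Sum>i\<in>T. \<Sum>j\<in>N. (norm (v i))\<^sup>2 + (norm (v j))\<^sup>2 - 2 * (v i \<bullet> v j))
      = k * (\<Sum>i\<in>T. (norm (v i))\<^sup>2) + k * (\<Sum>i\<in>N. (norm (v i))\<^sup>2) - 2 * (S \<bullet> sum v N)"
    unfolding S_def inner_sum_right inner_sum_left sum.swap[of _ N T]
    by (simp add: sum.distrib sum_subtractf cards sum_distrib_left)
  moreover have "(\<Sum>i\<in>T. \<Sum>j\<in>N. 2 * (S \<bullet> v i) - 2 * (S \<bullet> v j))
      = 2 * k * (S \<bullet> S) - 2 * k * (S \<bullet> sum v N)"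
    by (subst (2) S_def)
       (simp add: sum.distrib sum_subtractf cards sum_distrib_left inner_sum_right mult_ac)
  ultimately have "k * (\<Sum>i\<in>?I. (norm (v i))\<^sup>2) \<le> (4 * real k - 2) * (norm S)\<^sup>2"
    unfolding split[of "\<lambda>i. (norm (v i))\<^sup>2"] SN
    by (simp add: power2_norm_eq_inner algebra_simps)
  then show ?thesis using T unfolding S_def by blast
qed

text \<open>Families with fewer than \<open>2 k\<close> members are padded with zero vectors. In the application there are
  up to \<open>d + 1\<close> vectors; if \<open>d\<close> is even, this number is odd and at least one zero must be added,
  which produces the different constant there.\<close>

lemma balanced_subset_sum:
  fixes v :: "'b \<Rightarrow> 'a::real_inner"
  assumes "finite s" "card s \<le> 2 * k" and zero: "sum v s = 0"
  shows "\<exists>T\<subseteq>s. real k * (\<Sum>i\<in>s. (norm (v i))\<^sup>2) \<le> (4 * real k - 2) * (norm (sum v T))\<^sup>2"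
proof -
  let ?m = "card s"
  obtain h where h: "bij_betw h {..<?m} s"
    using ex_bij_betw_nat_finite[OF assms(1)] by (auto simp: atLeast0LessThan)
  define w where "w i = (if i < ?m then v (h i) else 0)" for i
  have restrict: "(\<Sum>i\<in>A. f (w i)) = (\<Sum>i\<in>A\<inter>{..<?m}. f (v (h i)))"
    if "f 0 = 0" "finite A" for A and f :: "'a \<Rightarrow> 'c::ab_group_add"
    using that by (subst sum.inter_restrict) (auto simp: w_def intro!: sum.cong)
  have inter: "{..<2*k} \<inter> {..<?m} = {..<?m}" using assms(2) by auto
  have all: "(\<Sum>i<2*k. f (w i)) = (\<Sum>i\<in>s. f (v i))"
    if "f 0 = 0" for f :: "'a \<Rightarrow> 'c::ab_group_add"
    using sum.reindex_bij_betw[OF h, of "\<lambda>i. f (v i)"] restrict[of f "{..<2*k}"] that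
    by (simp add: inter)
  obtain T where T: "T \<subseteq> {..<2*k}"
    "real k * (\<Sum>i<2*k. (norm (w i))\<^sup>2) \<le> (4 * real k - 2) * (norm (sum w T))\<^sup>2"
    using balanced_subset_sum_nat[of w k] all[of "\<lambda>x. x"] zero by auto
  let ?A = "T \<inter> {..<?m}"
  have "finite T" using T(1) finite_subset by blast
  then have "sum w T = (\<Sum>i\<in>?A. v (h i))"
    using restrict[of "\<lambda>x. x" T] by simp
  also have "\<dots> = sum v (h ` ?A)"
    using h by (subst sum.reindex) (auto simp: bij_betw_def inj_on_def)
  finally have "sum w T = sum v (h ` ?A)" .
  moreover have "h ` ?A \<subseteq> s" using h by (auto simp: bij_betw_def)
  ultimately show ?thesis using T(2) all[of "\<lambda>x. (norm x)\<^sup>2"] by auto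
qed

section \<open>Steinhagen's theorem\<close>

text \<open>Outer unit normals of the halfspaces containing \<open>K\<close> that touch the ball of radius \<open>r\<close> around
  \<open>c\<close>, when this ball lies in \<open>K\<close>.\<close>

definition contact_normals :: "(real ^ 'n) set \<Rightarrow> real ^ 'n \<Rightarrow> real \<Rightarrow> (real ^ 'n) set" where
  "contact_normals K c r = {a. norm a = 1 \<and> (\<forall>x\<in>K. a \<bullet> (x - c) \<le> r)}"

text \<open>Otherwise some \<open>w\<close> has \<open>w \<bullet> a > b > 0\<close> for all contact normals \<open>a\<close>, and moving the ball
  slightly in direction \<open>- w\<close> leaves room to enlarge it: if the ball around \<open>c - w / (n + 1)\<close> with
  radius \<open>r + b / (2 (n + 1))\<close> never fits into \<open>K\<close>, then the normals \<open>a\<^sub>n\<close> separating its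
  protruding points from \<open>K\<close> accumulate at a contact normal \<open>l\<close> with \<open>w \<bullet> l \<le> b / 2\<close>.\<close>

lemma zero_in_hull_contact_normals:
  fixes K :: "(real ^ 'n) set"
  assumes K: "convex_body K" and ball: "cball c (inradius K) \<subseteq> K" and r0: "0 \<le> inradius K"
  shows "0 \<in> convex hull (contact_normals K c (inradius K))"
proof (rule ccontr)
  let ?r = "inradius K" and ?U = "contact_normals K c (inradius K)"
  assume "0 \<notin> convex hull ?U"
  moreover have "closed (convex hull ?U)"
  proof -
    have "?U = sphere 0 1 \<inter> (\<Inter>x\<in>K. {a. a \<bullet> (x - c) \<le> ?r})"
      by (auto simp: contact_normals_def)
    moreover have "closed {a. a \<bullet> (x - c) \<le> ?r}" for x
      by (intro closed_Collect_le continuous_intros)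
    ultimately have "compact ?U" by (simp add: compact_Int_closed closed_INT)
    then show ?thesis by (simp add: compact_convex_hull compact_imp_closed)
  qed
  ultimately obtain w b where w: "0 < b" "\<And>a. a \<in> convex hull ?U \<Longrightarrow> w \<bullet> a > b"
    using separating_hyperplane_closed_0[OF convex_convex_hull] by metis
  let ?e = "\<lambda>n. 1 / real (Suc n)"
  have "\<exists>a. norm a = 1 \<and> w \<bullet> a \<le> b / 2 \<and> (\<forall>x\<in>K. a \<bullet> (x - c) \<le> ?r + ?e n * (b / 2 - w \<bullet> a))" for n
  proof -
    let ?c = "c - ?e n *\<^sub>R w" and ?R = "?r + ?e n * (b / 2)"
    have "?r < ?R" using w(1) by simp
    then have "\<not> cball ?c ?R \<subseteq> K" using inradius_ge[OF K, of ?R ?c] r0 by auto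
    then obtain y where "y \<in> cball ?c ?R" "y \<notin> K" by blast
    then have y: "norm (y - ?c) \<le> ?R" "y \<notin> K"
      by (simp_all add: dist_norm norm_minus_commute)
    have "closed K" "convex K" using K by (auto simp: convex_body_def compact_imp_closed)
    then obtain a0 t where a0: "a0 \<bullet> y < t" "\<forall>x\<in>K. a0 \<bullet> x > t"
      using separating_hyperplane_closed_point[of K y] y(2) by auto
    obtain p where "p \<in> K" using K by (auto simp: convex_body_def)
    then have "a0 \<noteq> 0" using a0 by force
    define a where "a = - sgn a0"
    have a: "norm a = 1" using \<open>a0 \<noteq> 0\<close> by (simp add: a_def norm_sgn)
    have sep: "a \<bullet> (x - c) \<le> ?r + ?e n * (b / 2 - w \<bullet> a)" if "x \<in> K" for x
    proof -
      have "a0 \<bullet> y \<le> a0 \<bullet> x" using a0 that by force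
      then have "(a0 \<bullet> y) / norm a0 \<le> (a0 \<bullet> x) / norm a0" by (simp add: divide_right_mono)
      then have "a \<bullet> x \<le> a \<bullet> y" by (simp add: a_def sgn_div_norm divide_inverse mult.commute)
      moreover have "a \<bullet> (y - ?c) \<le> ?R"
        using norm_cauchy_schwarz[of a "y - ?c"] y(1) a by simp
      ultimately show ?thesis
        by (simp add: inner_diff_right inner_add_right algebra_simps inner_commute)
    qed
    have "c + ?r *\<^sub>R a \<in> K" using ball a r0 by (auto simp: dist_norm)
    from sep[OF this] have "?r \<le> ?r + ?e n * (b / 2 - w \<bullet> a)"
      using a by (simp add: power2_norm_eq_inner[symmetric])
    then have "w \<bullet> a \<le> b / 2" by (simp add: zero_le_divide_iff)
    then show ?thesis using a sep by blast
  qed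
  then obtain a where a: "\<And>n. norm (a n) = 1" "\<And>n. w \<bullet> a n \<le> b / 2"
    "\<And>n x. x \<in> K \<Longrightarrow> a n \<bullet> (x - c) \<le> ?r + ?e n * (b / 2 - w \<bullet> a n)"
    by metis
  have "\<And>n. a n \<in> sphere 0 1" using a(1) by simp
  then obtain l f where l: "l \<in> sphere 0 1" "strict_mono f" "(a \<circ> f) \<longlonglongrightarrow> l"
    using compact_sphere[of "0 :: real ^ 'n" 1] unfolding compact_def by metis
  have lim: "(\<lambda>n. a (f n)) \<longlonglongrightarrow> l" using l(3) by (simp add: o_def)
  have e: "(\<lambda>n. ?e (f n)) \<longlonglongrightarrow> 0"
    using LIMSEQ_subseq_LIMSEQ[OF LIMSEQ_inverse_real_of_nat l(2)] by (simp add: o_def inverse_eq_divide)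
  have "l \<bullet> (x - c) \<le> ?r" if "x \<in> K" for x
  proof (rule LIMSEQ_le)
    show "(\<lambda>n. a (f n) \<bullet> (x - c)) \<longlonglongrightarrow> l \<bullet> (x - c)" by (intro tendsto_intros lim)
    have "(\<lambda>n. ?r + ?e (f n) * (b / 2 - w \<bullet> a (f n))) \<longlonglongrightarrow> ?r + 0 * (b / 2 - w \<bullet> l)"
      by (intro tendsto_intros lim e)
    then show "(\<lambda>n. ?r + ?e (f n) * (b / 2 - w \<bullet> a (f n))) \<longlonglongrightarrow> ?r" by simp
  qed (use a(3)[OF that] in blast)
  then have "l \<in> ?U" using l(1) by (simp add: contact_normals_def)
  then have "b < w \<bullet> l" by (intro w(2) hull_inc)
  moreover have "w \<bullet> l \<le> b / 2"
    by (rule LIMSEQ_le_const2[OF tendsto_inner[OF tendsto_const lim]]) (use a(2) in blast)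
  ultimately show False using w(1) by simp
qed

text \<open>By Caratheodory the origin is a convex combination of at most \<open>d + 1\<close> contact normals \<open>v\<close>, with
  weights \<open>u v\<close>. For a subset \<open>T\<close> of them put \<open>a = (\<Sum>v\<in>T. u v *\<^sub>R v)\<close>, which is also
  minus the sum over the complement. The normals in \<open>T\<close> bound \<open>a \<bullet> x\<close> from above and the others
  bound it from below, so the extent of \<open>K\<close> along \<open>a\<close> is at most \<open>r\<close> times the total weight \<open>1\<close>.
  A small width thus needs a long vector \<open>a\<close>, which \<open>balanced_subset_sum\<close> provides; the
  squared weights sum to at least \<open>1 / (d + 1)\<close> by the Cauchy--Schwarz inequality.\<close>

lemma half_width_le_of_dim_less:
  fixes K :: "(real ^ 'n) set"
  assumes K: "convex_body K" and k: "CARD('n) + 1 \<le> 2 * k"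
  shows "half_width K \<le> sqrt ((2 * real k - 1) * (real CARD('n) + 1) / (2 * real k)) * inradius K"
proof -
  let ?r = "inradius K" and ?d = "real CARD('n)"
  obtain c where r0: "0 \<le> ?r" and ball: "cball c ?r \<subseteq> K" using inradius_attained[OF K] .
  let ?U = "contact_normals K c ?r"
  obtain s where s: "finite s" "s \<subseteq> ?U" "card s \<le> CARD('n) + 1" "0 \<in> convex hull s"
    using zero_in_hull_contact_normals[OF K ball r0] unfolding caratheodory[of ?U] by auto
  then obtain u where u: "\<And>v. v \<in> s \<Longrightarrow> 0 \<le> u v" "sum u s = 1" "(\<Sum>v\<in>s. u v *\<^sub>R v) = 0"
    unfolding convex_hull_finite[OF s(1)] by auto
  define f where "f v = u v *\<^sub>R v" for v
  obtain T where T: "T \<subseteq> s"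
    "real k * (\<Sum>v\<in>s. (norm (f v))\<^sup>2) \<le> (4 * real k - 2) * (norm (sum f T))\<^sup>2"
    using balanced_subset_sum[of s k f] s(1,3) k u(3) by (auto simp: f_def)
  let ?a = "sum f T"
  have k1: "real k \<ge> 1" using k by simp
  have norms: "(\<Sum>v\<in>s. (norm (f v))\<^sup>2) = (\<Sum>v\<in>s. (u v)\<^sup>2)"
    using s(2) by (intro sum.cong) (auto simp: f_def contact_normals_def)
  have "1 \<le> (\<Sum>v\<in>s. (u v)\<^sup>2) * (?d + 1)"
  proof -
    have "1 \<le> (\<Sum>v\<in>s. (u v)\<^sup>2) * card s"
      using sum_squared_le_sum_of_squares[of u s] u(2) by simp
    also have "\<dots> \<le> (\<Sum>v\<in>s. (u v)\<^sup>2) * (?d + 1)"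
      using s(3) by (intro mult_left_mono sum_nonneg) auto
    finally show ?thesis .
  qed
  then have "real k / (?d + 1) \<le> real k * (\<Sum>v\<in>s. (u v)\<^sup>2)"
    using k1 by (simp add: pos_divide_le_eq mult.assoc)
  then have lower: "real k / (?d + 1) \<le> (4 * real k - 2) * (norm ?a)\<^sup>2"
    using T(2) unfolding norms by (rule order_trans)
  then have "?a \<noteq> 0" using k1 by (auto simp: divide_le_0_iff)
  have width: "?a \<bullet> x - ?a \<bullet> y \<le> ?r" if "x \<in> K" "y \<in> K" for x y
  proof -
    have contact: "f v \<bullet> (z - c) \<le> u v * ?r" if "v \<in> s" "z \<in> K" for v z
      using that s(2) u(1)[OF that(1)] by (auto simp: f_def contact_normals_def intro!: mult_left_mono)
    have "sum f s = ?a + sum f (s - T)"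
      using sum.subset_diff[OF T(1) s(1), of f] by (simp add: add.commute)
    then have "?a = - sum f (s - T)"
      using u(3) by (simp add: f_def eq_neg_iff_add_eq_0)
    then have "?a \<bullet> x - ?a \<bullet> y = ?a \<bullet> (x - c) + sum f (s - T) \<bullet> (y - c)"
      by (simp add: inner_diff_right)
    also have "\<dots> = (\<Sum>v\<in>T. f v \<bullet> (x - c)) + (\<Sum>v\<in>s - T. f v \<bullet> (y - c))"
      by (simp add: inner_sum_left)
    also have "\<dots> \<le> (\<Sum>v\<in>T. u v * ?r) + (\<Sum>v\<in>s - T. u v * ?r)"
      using that T(1) by (intro add_mono sum_mono contact) auto
    also have "\<dots> = (\<Sum>v\<in>s. u v * ?r)"
      using sum.subset_diff[OF T(1) s(1), of "\<lambda>v. u v * ?r"] by simp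
    also have "\<dots> = ?r" using u(2) by (simp add: sum_distrib_right[symmetric])
    finally show ?thesis .
  qed
  have "half_width K * (2 * norm ?a) \<le> ?r"
    using half_width_times_norm_le[OF K \<open>?a \<noteq> 0\<close> width] .
  then have "(half_width K * (2 * norm ?a))\<^sup>2 \<le> ?r\<^sup>2"
    using half_width_nonneg[OF K] by (intro power_mono) auto
  then have sq: "(half_width K)\<^sup>2 * (4 * (norm ?a)\<^sup>2) \<le> ?r\<^sup>2" by (simp add: power_mult_distrib)
  let ?q = "(2 * real k - 1) * (?d + 1) / (2 * real k)"
  have q0: "0 < ?q" using k1 by (simp add: zero_less_mult_iff)
  have "real k \<le> (4 * real k - 2) * (norm ?a)\<^sup>2 * (?d + 1)"
    using lower by (simp add: pos_divide_le_eq)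
  then have "2 * real k \<le> 4 * (norm ?a)\<^sup>2 * ((2 * real k - 1) * (?d + 1))"
    by (simp add: algebra_simps)
  then have "2 * real k / ((2 * real k - 1) * (?d + 1)) \<le> 4 * (norm ?a)\<^sup>2"
    using k1 by (subst pos_divide_le_eq) (auto simp: zero_less_mult_iff)
  then have "1 / ?q \<le> 4 * (norm ?a)\<^sup>2" by simp
  then have "(half_width K)\<^sup>2 * (1 / ?q) \<le> ?r\<^sup>2"
    using mult_left_mono[of "1 / ?q" "4 * (norm ?a)\<^sup>2" "(half_width K)\<^sup>2"] sq by simp
  then have "(half_width K)\<^sup>2 \<le> ?q * ?r\<^sup>2"
    using q0 by (metis mult.commute mult.right_neutral pos_divide_le_eq times_divide_eq_right)
  then have "sqrt ((half_width K)\<^sup>2) \<le> sqrt (?q * ?r\<^sup>2)" by (rule real_sqrt_le_mono)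
  then show ?thesis
    using half_width_nonneg[OF K] r0 by (simp only: real_sqrt_mult real_sqrt_abs abs_of_nonneg)
qed

text \<open>The optimal ratio between half width and inradius in Steinhagen's theorem, attained by the regular
  simplex.\<close>

definition steinhagen_constant :: "nat \<Rightarrow> real" where
  "steinhagen_constant d = (if odd d then sqrt (real d) else (real d + 1) / sqrt (real d + 2))"

lemma ratio_bound_eq: "ratio_bound d s = min (steinhagen_constant d) ((s + 1) / 2)"
  by (simp add: ratio_bound_def steinhagen_constant_def)

text \<open>The smallest admissible \<open>k\<close> is best: \<open>2 k = d + 1\<close> if \<open>d\<close> is odd and \<open>2 k = d + 2\<close> if
  \<open>d\<close> is even.\<close>

theorem steinhagen:
  fixes K :: "(real ^ 'n) set"
  assumes K: "convex_body K"
  shows "half_width K \<le> steinhagen_constant CARD('n) * inradius K"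
proof (cases "odd CARD('n)")
  case True
  then obtain j where j: "CARD('n) = 2 * j + 1" by (elim oddE)
  have "(2 * real (j + 1) - 1) * (real CARD('n) + 1) / (2 * real (j + 1)) = real CARD('n)"
    by (simp add: j field_simps)
  then show ?thesis
    using half_width_le_of_dim_less[OF K, of "j + 1"] True j
    by (simp add: steinhagen_constant_def)
next
  case False
  then have "even CARD('n)" by simp
  then obtain j where j: "CARD('n) = 2 * j" by (rule evenE)
  have "(2 * real (j + 1) - 1) * (real CARD('n) + 1) / (2 * real (j + 1))
      = (real CARD('n) + 1)\<^sup>2 / (real CARD('n) + 2)"
    by (simp add: j power2_eq_square add.commute)
  then have "sqrt ((2 * real (j + 1) - 1) * (real CARD('n) + 1) / (2 * real (j + 1)))
      = steinhagen_constant CARD('n)"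
    using False by (simp add: steinhagen_constant_def real_sqrt_divide)
  then show ?thesis
    using half_width_le_of_dim_less[OF K, of "j + 1"] j by simp
qed

lemma steinhagen_constant_ge_1:
  assumes "0 < d"
  shows "1 \<le> steinhagen_constant d"
proof (cases "odd d")
  case False
  have "1 \<le> real d" using assms by simp
  then have "1 \<le> real d + real d * real d" by (simp add: add_increasing2)
  then have "sqrt (real d + 2) \<le> real d + 1"
    by (intro real_le_lsqrt) (auto simp: power2_eq_square algebra_simps)
  then show ?thesis using False by (simp add: steinhagen_constant_def pos_le_divide_eq)
qed (use assms in \<open>simp add: steinhagen_constant_def\<close>)

text \<open>For a body with inradius \<open>0\<close> the half width vanishes as well, so the ratio is \<open>1\<close> by
  convention, and both terms of the minimum are at least \<open>1\<close>.\<close>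

lemma ratio_le_ratio_bound:
  fixes K :: "(real ^ 'n) set"
  assumes K: "convex_body K" "\<nexists>p. K = {p}"
  shows "ratio (half_width K) (inradius K) \<le> ratio_bound CARD('n) (minkowski_asymmetry K)"
proof (cases "inradius K = 0")
  case True
  then have "half_width K = 0"
    using half_width_le_asymmetry_inradius[OF K(1)] half_width_nonneg[OF K(1)] by simp
  then show ?thesis
    using True steinhagen_constant_ge_1[of "CARD('n)"] minkowski_asymmetry_ge_1[OF K]
    by (simp add: ratio_def ratio_bound_eq)
next
  case False
  then have "0 < inradius K" using inradius_attained[OF K(1)] by force
  then show ?thesis
    using half_width_le_asymmetry_inradius[OF K(1)] steinhagen[OF K(1)]
    by (simp add: ratio_def ratio_bound_eq pos_divide_le_eq)
qed

section \<open>Truncated regular simplices\<close>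

text \<open>The outer unit normals of a regular simplex with inradius \<open>1\<close>, indexed by \<open>'n option\<close> because
  there is one more of them than there are coordinates. The last condition says that they span the
  space.\<close>

definition simplex_normals :: "('n option \<Rightarrow> real ^ 'n) \<Rightarrow> bool" where
  "simplex_normals u \<longleftrightarrow>
     (\<forall>i. u i \<bullet> u i = 1) \<and> (\<forall>i j. i \<noteq> j \<longrightarrow> u i \<bullet> u j = - 1 / real CARD('n)) \<and>
     (\<forall>x. (\<forall>i. u i \<bullet> x = 0) \<longrightarrow> x = 0)"

text \<open>One normal points along \<open>- (1, \<dots>, 1)\<close>; the others are unit vectors stretched by \<open>\<alpha>\<close> and
  shifted along \<open>(1, \<dots>, 1)\<close> by \<open>\<beta>\<close>. The prescribed inner
  products force \<open>\<alpha> + \<beta> d = 1 / sqrt d\<close> and \<open>\<alpha>\<^sup>2 = 1 + 1 / d\<close>.\<close>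

lemma ex_simplex_normals: "\<exists>u :: 'n option \<Rightarrow> real ^ 'n. simplex_normals u"
proof -
  let ?d = "real CARD('n)"
  have d: "0 < ?d" by simp
  define \<alpha> where "\<alpha> = sqrt (1 + 1 / ?d)"
  define \<beta> where "\<beta> = (1 / sqrt ?d - \<alpha>) / ?d"
  define e :: "real ^ 'n" where "e = (\<chi> i. 1)"
  define u :: "'n option \<Rightarrow> real ^ 'n" where
    "u i = (case i of None \<Rightarrow> (- 1 / sqrt ?d) *\<^sub>R e | Some k \<Rightarrow> \<alpha> *\<^sub>R axis k 1 + \<beta> *\<^sub>R e)" for i
  have ee: "e \<bullet> e = ?d" by (simp add: e_def inner_vec_def)
  have ae: "axis k 1 \<bullet> e = 1" "e \<bullet> axis k 1 = 1" for k :: 'n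
    by (simp_all add: e_def inner_axis inner_axis')
  have aa: "axis k 1 \<bullet> (axis l 1 :: real ^ 'n) = (if k = l then 1 else 0)" for k l :: 'n
    by (simp add: inner_axis_axis)
  have \<alpha>2: "\<alpha>\<^sup>2 = 1 + 1 / ?d" using d by (simp add: \<alpha>_def)
  have \<alpha>0: "0 < \<alpha>" using d by (simp add: \<alpha>_def add_pos_pos)
  have \<beta>: "\<alpha> + \<beta> * ?d = 1 / sqrt ?d" using d by (simp add: \<beta>_def)
  have "2 * \<alpha> * \<beta> + \<beta>\<^sup>2 * ?d = \<beta> * (\<alpha> + 1 / sqrt ?d)"
    unfolding \<beta>[symmetric] by (simp add: power2_eq_square algebra_simps)
  also have "\<dots> = ((1 / sqrt ?d)\<^sup>2 - \<alpha>\<^sup>2) / ?d"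
    by (simp add: \<beta>_def power2_eq_square algebra_simps)
  also have "\<dots> = - 1 / ?d"
    using d by (simp add: \<alpha>2 power_divide)
  finally have cross: "2 * \<alpha> * \<beta> + \<beta>\<^sup>2 * ?d = - 1 / ?d" .
  have sqd: "sqrt ?d * sqrt ?d = ?d" using d by simp
  have NN: "u None \<bullet> u None = 1"
    using d by (simp add: u_def ee)
  have NS: "u None \<bullet> u (Some k) = - 1 / ?d" "u (Some k) \<bullet> u None = - 1 / ?d" for k
  proof -
    have "u None \<bullet> u (Some k) = (- 1 / sqrt ?d) * (\<alpha> + \<beta> * ?d)"
      by (simp add: u_def ee ae inner_add_right algebra_simps)
    then show "u None \<bullet> u (Some k) = - 1 / ?d" unfolding \<beta> using sqd by simp
    then show "u (Some k) \<bullet> u None = - 1 / ?d" by (simp add: inner_commute)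
  qed
  have SS: "u (Some k) \<bullet> u (Some l) = (if k = l then 1 else - 1 / ?d)" for k l
  proof -
    have "u (Some k) \<bullet> u (Some l) = \<alpha>\<^sup>2 * (if k = l then 1 else 0) + (2 * \<alpha> * \<beta> + \<beta>\<^sup>2 * ?d)"
      by (simp add: u_def ee ae aa inner_add_right inner_add_left power2_eq_square algebra_simps)
    then show ?thesis unfolding cross \<alpha>2 by simp
  qed
  have "x = 0" if x: "\<And>i. u i \<bullet> x = 0" for x
  proof -
    have e: "e \<bullet> x = 0" using x[of None] d by (simp add: u_def)
    then have "axis k 1 \<bullet> x = 0" for k
      using x[of "Some k"] \<alpha>0 by (simp add: u_def inner_add_left)
    then show ?thesis by (simp add: vec_eq_iff inner_axis')
  qed
  moreover have "u i \<bullet> u i = 1" "i \<noteq> j \<Longrightarrow> u i \<bullet> u j = - 1 / ?d" for i j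
    using NN NS SS by (cases i; cases j; auto)+
  ultimately have "simplex_normals u" by (auto simp: simplex_normals_def)
  then show ?thesis by blast
qed

text \<open>Interpolating linearly between \<open>l\<close> and \<open>h\<close> moves the sum from nonpositive to nonnegative.\<close>

lemma ex_between_sum:
  fixes l h :: "'b::finite \<Rightarrow> real"
  assumes "\<And>i. l i \<le> h i" "sum l UNIV \<le> 0" "0 \<le> sum h UNIV"
  shows "\<exists>t. (\<forall>i. l i \<le> t i \<and> t i \<le> h i) \<and> sum t UNIV = 0"
proof (cases "sum l UNIV = sum h UNIV")
  case True
  then show ?thesis using assms by (intro exI[of _ l]) auto
next
  case False
  let ?L = "sum l UNIV" and ?H = "sum h UNIV"
  define \<theta> where "\<theta> = - ?L / (?H - ?L)"
  have pos: "0 < ?H - ?L" using False assms(2,3) by simp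
  have \<theta>: "0 \<le> \<theta>" "\<theta> \<le> 1" using pos assms(2,3) by (simp_all add: \<theta>_def divide_le_0_iff pos_le_divide_eq)
  let ?t = "\<lambda>i. l i + \<theta> * (h i - l i)"
  have "l i \<le> ?t i \<and> ?t i \<le> h i" for i
    using \<theta> assms(1)[of i] mult_left_le_one_le[of "h i - l i" \<theta>] by auto
  moreover have "sum ?t UNIV = ?L + \<theta> * (?H - ?L)"
    by (simp add: sum.distrib sum_subtractf sum_distrib_left[symmetric])
  then have "sum ?t UNIV = 0" using pos by (simp add: \<theta>_def)
  ultimately show ?thesis by (intro exI[of _ ?t]) simp
qed

context
  fixes u :: "'n option \<Rightarrow> real ^ 'n"
  assumes u: "simplex_normals u"
begin

lemma simplex_inner: "u i \<bullet> u j = (if i = j then 1 else - 1 / real CARD('n))"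
  using u by (simp add: simplex_normals_def)

lemma simplex_norm: "norm (u i) = 1"
  by (simp add: norm_eq_sqrt_inner simplex_inner)

lemma sum_simplex_inner:
  "(\<Sum>j\<in>I. t j * (u i \<bullet> u j))
    = (if i \<in> I then (1 + 1 / real CARD('n)) * t i else 0) - sum t I / real CARD('n)"
proof -
  have "(\<Sum>j\<in>I. t j * (u i \<bullet> u j))
      = (\<Sum>j\<in>I. (if i = j then (1 + 1 / real CARD('n)) * t j else 0) - t j / real CARD('n))"
    by (intro sum.cong) (auto simp: simplex_inner algebra_simps)
  also have "\<dots> = (if i \<in> I then (1 + 1 / real CARD('n)) * t i else 0) - sum t I / real CARD('n)"
    by (simp add: sum_subtractf sum_divide_distrib)
  finally show ?thesis .
qed

lemma sum_simplex_normals: "sum u UNIV = 0"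
proof -
  have "u i \<bullet> sum u UNIV = 0" for i
    using sum_simplex_inner[of "\<lambda>_. 1" i UNIV]
    by (simp add: inner_sum_right card_UNIV_option add_divide_distrib)
  then show ?thesis using u by (simp add: simplex_normals_def)
qed

lemma simplex_coordinates_sum: "(\<Sum>i\<in>UNIV. u i \<bullet> x) = 0"
  using sum_simplex_normals by (simp add: inner_sum_left[symmetric])

text \<open>A point may be prescribed by its inner products with the normals, as long as these sum to \<open>0\<close>.
  Hence problems about the simplex become problems about such families of reals.\<close>

lemma ex_simplex_coordinates:
  assumes "sum t UNIV = 0"
  shows "\<exists>x. \<forall>i. u i \<bullet> x = t i"
proof -
  let ?q = "1 + 1 / real CARD('n)"
  have "?q \<noteq> 0" by (smt (verit) divide_nonneg_nonneg of_nat_0_le_iff)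
  then have "u i \<bullet> ((1 / ?q) *\<^sub>R (\<Sum>j\<in>UNIV. t j *\<^sub>R u j)) = t i" for i
    using sum_simplex_inner[of t i UNIV] assms by (simp add: inner_sum_right)
  then show ?thesis by blast
qed

lemma simplex_coordinates_eqI:
  assumes "\<And>i. u i \<bullet> x = u i \<bullet> y"
  shows "x = y"
  using u assms unfolding simplex_normals_def
  by (metis eq_iff_diff_eq_0 inner_diff_right)

text \<open>For \<open>k\<close> normals the squared norm is \<open>k (d + 1 - k) / d\<close>. It is largest for \<open>k = (d + 1) / 2\<close>
  if \<open>d\<close> is odd; if \<open>d\<close> is even, \<open>d + 1 - 2 k\<close> cannot vanish, which lowers the maximum and gives
  the other branch of the constant.\<close>

lemma norm_sum_simplex_normals_le:
  "2 * steinhagen_constant CARD('n) * norm (sum u I) \<le> real CARD('n) + 1"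
proof -
  let ?d = "real CARD('n)" and ?B = "steinhagen_constant CARD('n)" and ?k = "real (card I)"
  have d: "0 < ?d" by simp
  have B0: "0 \<le> ?B" by (simp add: steinhagen_constant_def)
  have "(norm (sum u I))\<^sup>2 = (\<Sum>i\<in>I. \<Sum>j\<in>I. 1 * (u i \<bullet> u j))"
    by (simp add: power2_norm_eq_inner inner_sum_left inner_sum_right inner_commute)
  also have "\<dots> = ?k * (?d + 1 - ?k) / ?d"
    using d by (simp add: sum_simplex_inner[of "\<lambda>_. 1", simplified] sum_subtractf field_simps)
  finally have n: "(norm (sum u I))\<^sup>2 = ?k * (?d + 1 - ?k) / ?d" .
  have "?B\<^sup>2 * (4 * (?k * (?d + 1 - ?k))) \<le> (?d + 1)\<^sup>2 * ?d"
  proof (cases "odd CARD('n)")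
    case True
    have "0 \<le> (?d + 1 - 2 * ?k)\<^sup>2" by simp
    then have "4 * (?k * (?d + 1 - ?k)) \<le> (?d + 1)\<^sup>2"
      by (simp add: power2_eq_square algebra_simps)
    then show ?thesis using True mult_left_mono[of _ _ ?d]
      by (simp add: steinhagen_constant_def mult.commute)
  next
    case False
    have "CARD('n) + 1 - 2 * int (card I) \<noteq> 0" using False by presburger
    then have "1 \<le> (CARD('n) + 1 - 2 * int (card I))\<^sup>2"
      by (smt (verit) zero_less_power2)
    then have "1 \<le> real_of_int ((CARD('n) + 1 - 2 * int (card I))\<^sup>2)"
      by linarith
    then have "1 \<le> (?d + 1 - 2 * ?k)\<^sup>2" by (simp add: add.commute)
    then have "4 * (?k * (?d + 1 - ?k)) \<le> ?d * (?d + 2)"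
      by (simp add: power2_eq_square algebra_simps)
    then have "?B\<^sup>2 * (4 * (?k * (?d + 1 - ?k))) \<le> ?B\<^sup>2 * (?d * (?d + 2))"
      by (intro mult_left_mono) auto
    also have "\<dots> = (?d + 1)\<^sup>2 * ?d"
      using False d by (simp add: steinhagen_constant_def power_divide)
    finally show ?thesis .
  qed
  then have "?B\<^sup>2 * (4 * (?k * (?d + 1 - ?k))) / ?d \<le> (?d + 1)\<^sup>2"
    using d by (simp add: pos_divide_le_eq)
  moreover have "(2 * ?B * norm (sum u I))\<^sup>2 = ?B\<^sup>2 * (4 * (?k * (?d + 1 - ?k))) / ?d"
    by (simp add: power_mult_distrib n)
  ultimately have "(2 * ?B * norm (sum u I))\<^sup>2 \<le> (?d + 1)\<^sup>2" by simp
  then show ?thesis by (rule power2_le_imp_le) simp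
qed

text \<open>The intersection of the simplex \<open>S\<close> with facet normals \<open>u i\<close> and inradius \<open>1\<close> with
  \<open>- \<sigma> S\<close>. It interpolates between the symmetric body \<open>S \<inter> - S\<close> at \<open>\<sigma> = 1\<close> and \<open>S\<close>
  itself at \<open>\<sigma> = d\<close>.\<close>

definition truncated_simplex :: "real \<Rightarrow> (real ^ 'n) set" where
  "truncated_simplex \<sigma> = {x. \<forall>i. - \<sigma> \<le> u i \<bullet> x \<and> u i \<bullet> x \<le> 1}"

text \<open>Boundedness follows from the expansion of \<open>x\<close> as \<open>d / (d + 1)\<close> times the sum of the
  \<open>(u i \<bullet> x) *\<^sub>R u i\<close>.\<close>

lemma convex_body_truncated_simplex:
  assumes "0 \<le> \<sigma>"
  shows "convex_body (truncated_simplex \<sigma>)"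
proof -
  have eq: "truncated_simplex \<sigma> = (\<Inter>i. {x. u i \<bullet> x \<ge> - \<sigma>} \<inter> {x. u i \<bullet> x \<le> 1})"
    by (auto simp: truncated_simplex_def)
  have "convex (truncated_simplex \<sigma>)" "closed (truncated_simplex \<sigma>)"
    unfolding eq
    by (auto intro!: convex_INT convex_Int closed_INT closed_Int
        convex_halfspace_ge convex_halfspace_le closed_halfspace_ge closed_halfspace_le)
  moreover have "bounded (truncated_simplex \<sigma>)"
  proof -
    let ?q = "1 + 1 / real CARD('n)"
    have q: "?q \<ge> 1" "?q \<noteq> 0" by (simp, smt (verit) divide_nonneg_nonneg of_nat_0_le_iff)
    have "norm x \<le> (1 / ?q) * (\<Sum>i\<in>(UNIV :: 'n option set). max \<sigma> 1)" if x: "x \<in> truncated_simplex \<sigma>" for x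
    proof -
      have "u i \<bullet> x = u i \<bullet> ((1 / ?q) *\<^sub>R (\<Sum>j\<in>UNIV. (u j \<bullet> x) *\<^sub>R u j))" for i
        using sum_simplex_inner[of "\<lambda>j. u j \<bullet> x" i UNIV] simplex_coordinates_sum[of x] q(2)
        by (simp add: inner_sum_right)
      then have "x = (1 / ?q) *\<^sub>R (\<Sum>j\<in>UNIV. (u j \<bullet> x) *\<^sub>R u j)"
        by (rule simplex_coordinates_eqI)
      then have "norm x = (1 / ?q) * norm (\<Sum>j\<in>UNIV. (u j \<bullet> x) *\<^sub>R u j)"
        using q by (metis abs_of_nonneg dual_order.trans norm_scaleR zero_le_divide_1_iff zero_le_one)
      also have "\<dots> \<le> (1 / ?q) * (\<Sum>i\<in>(UNIV :: 'n option set). max \<sigma> 1)"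
      proof (intro mult_left_mono sum_norm_le)
        fix i
        have "- \<sigma> \<le> u i \<bullet> x" "u i \<bullet> x \<le> 1" using x by (auto simp: truncated_simplex_def)
        then show "norm ((u i \<bullet> x) *\<^sub>R u i) \<le> max \<sigma> 1"
          by (simp add: simplex_norm abs_le_iff) linarith
      qed (use q in simp)
      finally show ?thesis .
    qed
    then show ?thesis by (rule boundedI)
  qed
  moreover have "0 \<in> truncated_simplex \<sigma>" using assms by (simp add: truncated_simplex_def)
  ultimately show ?thesis by (auto simp: convex_body_def compact_eq_bounded_closed)
qed

lemma inner_simplex_normal_le: "\<bar>u i \<bullet> x\<bar> \<le> norm x"
  using Cauchy_Schwarz_ineq2[of "u i" x] by (simp add: simplex_norm)

text \<open>Summing over the facets of the simplex removes the centre of a contained ball.\<close>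

lemma inradius_truncated_simplex:
  assumes "1 \<le> \<sigma>"
  shows "inradius (truncated_simplex \<sigma>) = 1"
proof (rule antisym)
  have body: "convex_body (truncated_simplex \<sigma>)"
    using assms by (intro convex_body_truncated_simplex) simp
  have "cball 0 1 \<subseteq> truncated_simplex \<sigma>"
  proof
    fix x :: "real ^ 'n" assume "x \<in> cball 0 1"
    then have "\<bar>u i \<bullet> x\<bar> \<le> 1" for i
      using inner_simplex_normal_le[of i x] by simp
    then show "x \<in> truncated_simplex \<sigma>"
      using assms unfolding truncated_simplex_def by (smt (verit) mem_Collect_eq)
  qed
  then show "1 \<le> inradius (truncated_simplex \<sigma>)"
    using inradius_ge[OF body] by simp
  let ?r = "inradius (truncated_simplex \<sigma>)"
  obtain c where "0 \<le> ?r" and c: "cball c ?r \<subseteq> truncated_simplex \<sigma>"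
    using inradius_attained[OF body] .
  have "u i \<bullet> c + ?r \<le> 1" for i
  proof -
    have "c + ?r *\<^sub>R u i \<in> truncated_simplex \<sigma>"
      using c \<open>0 \<le> ?r\<close> by (auto simp: simplex_norm dist_norm)
    then have "u i \<bullet> (c + ?r *\<^sub>R u i) \<le> 1" by (simp add: truncated_simplex_def)
    then show ?thesis by (simp add: inner_add_right simplex_inner)
  qed
  then have "(\<Sum>i\<in>(UNIV :: 'n option set). u i \<bullet> c + ?r) \<le> (\<Sum>i\<in>(UNIV :: 'n option set). 1)"
    by (rule sum_mono)
  then show "?r \<le> 1"
    by (simp add: sum.distrib simplex_coordinates_sum card_UNIV_option)
qed

text \<open>The body \<open>K = S \<inter> - \<sigma> S\<close> satisfies \<open>- K \<subseteq> \<sigma> K\<close> as \<open>\<sigma> \<ge> 1\<close>. This is optimal: \<open>- K\<close>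
  contains the points \<open>\<sigma> u i\<close>, precisely because \<open>\<sigma> \<le> d\<close>, and they touch all facets of
  \<open>\<sigma> S\<close>. Summing the \<open>d + 1\<close> facet inequalities removes any translation.\<close>

lemma minkowski_asymmetry_truncated_simplex:
  assumes \<sigma>: "1 \<le> \<sigma>" "\<sigma> \<le> real CARD('n)"
  shows "minkowski_asymmetry (truncated_simplex \<sigma>) = \<sigma>"
  unfolding minkowski_asymmetry_def asymmetry_factors_def[symmetric]
proof (rule cInf_eq_minimum)
  show "\<sigma> \<in> asymmetry_factors (truncated_simplex \<sigma>)"
  proof (rule asymmetry_factorI[of _ _ 0])
    fix x assume "x \<in> truncated_simplex \<sigma>"
    then have x: "\<And>i. - \<sigma> \<le> u i \<bullet> x" "\<And>i. u i \<bullet> x \<le> 1"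
      by (auto simp: truncated_simplex_def)
    have "- \<sigma> * \<sigma> \<le> - 1 * 1" using mult_mono[of 1 \<sigma> 1 \<sigma>] \<sigma> by simp
    then have "- (u i \<bullet> x) / \<sigma> \<le> 1 \<and> - \<sigma> \<le> - (u i \<bullet> x) / \<sigma>" for i
      using x[of i] \<sigma> by (simp add: field_simps)
    then have "- (1 / \<sigma>) *\<^sub>R x \<in> truncated_simplex \<sigma>"
      by (simp add: truncated_simplex_def)
    moreover have "- x = 0 + \<sigma> *\<^sub>R (- (1 / \<sigma>) *\<^sub>R x)" using \<sigma> by simp
    ultimately show "\<exists>y\<in>truncated_simplex \<sigma>. - x = 0 + \<sigma> *\<^sub>R y" by blast
  qed (use \<sigma> in simp)
  fix \<rho> assume "\<rho> \<in> asymmetry_factors (truncated_simplex \<sigma>)"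
  then obtain c where "0 \<le> \<rho>"
    and c: "\<And>x. x \<in> truncated_simplex \<sigma> \<Longrightarrow> \<exists>y\<in>truncated_simplex \<sigma>. - x = c + \<rho> *\<^sub>R y"
    using asymmetry_factorD by metis
  have "\<sigma> \<le> u i \<bullet> c + \<rho>" for i
  proof -
    have "- \<sigma> \<le> u j \<bullet> (- \<sigma> *\<^sub>R u i) \<and> u j \<bullet> (- \<sigma> *\<^sub>R u i) \<le> 1" for j
      using \<sigma> by (auto simp: simplex_inner field_simps)
    then have "- \<sigma> *\<^sub>R u i \<in> truncated_simplex \<sigma>" by (simp add: truncated_simplex_def)
    then obtain y where y: "y \<in> truncated_simplex \<sigma>" "\<sigma> *\<^sub>R u i = c + \<rho> *\<^sub>R y"
      using c by fastforce
    have "\<sigma> = u i \<bullet> (\<sigma> *\<^sub>R u i)" by (simp add: simplex_inner)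
    also have "\<dots> = u i \<bullet> c + \<rho> * (u i \<bullet> y)" unfolding y(2) by (simp add: inner_add_right)
    also have "\<rho> * (u i \<bullet> y) \<le> \<rho> * 1"
      using y(1) \<open>0 \<le> \<rho>\<close> by (intro mult_left_mono) (auto simp: truncated_simplex_def)
    finally show ?thesis by simp
  qed
  then have "(\<Sum>i\<in>(UNIV :: 'n option set). \<sigma>) \<le> (\<Sum>i\<in>(UNIV :: 'n option set). u i \<bullet> c + \<rho>)"
    by (rule sum_mono)
  then show "\<sigma> \<le> \<rho>"
    by (simp add: sum.distrib simplex_coordinates_sum card_UNIV_option)
qed

text \<open>The positive parts add up to the inner product of \<open>x\<close> with the sum of those normals that have
  positive inner product with \<open>x\<close>.\<close>

lemma sum_pos_part_le:
  "(\<Sum>i\<in>UNIV. max 0 (u i \<bullet> x)) * (2 * steinhagen_constant CARD('n)) \<le> norm x * (real CARD('n) + 1)"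
proof -
  let ?I = "{i. 0 < u i \<bullet> x}" and ?B = "2 * steinhagen_constant CARD('n)"
  have "(\<Sum>i\<in>UNIV. max 0 (u i \<bullet> x)) = (\<Sum>i\<in>?I. u i \<bullet> x)"
    by (intro sum.mono_neutral_cong_right) auto
  also have "\<dots> = sum u ?I \<bullet> x" by (simp add: inner_sum_left)
  also have "\<dots> \<le> norm (sum u ?I) * norm x" by (rule norm_cauchy_schwarz)
  finally have "(\<Sum>i\<in>UNIV. max 0 (u i \<bullet> x)) * ?B \<le> (norm (sum u ?I) * norm x) * ?B"
    by (intro mult_right_mono) (auto simp: steinhagen_constant_def)
  also have "\<dots> = norm x * (?B * norm (sum u ?I))" by simp
  also have "\<dots> \<le> norm x * (real CARD('n) + 1)"
    by (intro mult_left_mono norm_sum_simplex_normals_le) simp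
  finally show ?thesis .
qed

text \<open>Writing \<open>x = k - (k - x)\<close> with both points in the body amounts to choosing coordinates \<open>t i\<close> of
  \<open>k\<close> in the interval from \<open>(x i)\<^sup>+ - \<sigma>\<close> to \<open>1 - (x i)\<^sup>-\<close>, with sum \<open>0\<close>, where
  \<open>x i = u i \<bullet> x\<close>. The intervals are nonempty when all coordinates have size at most \<open>\<sigma> + 1\<close>,
  and the sum can be made \<open>0\<close> when the positive and the negative parts sum to at most \<open>d + 1\<close>.
  These two conditions explain the minimum in the bound: the first holds if
  \<open>norm x \<le> \<sigma> + 1\<close>, the second if \<open>norm x\<close> is at most twice the Steinhagen constant.\<close>

lemma cball_subset_difference_truncated_simplex:
  assumes \<sigma>: "1 \<le> \<sigma>"
  shows "cball 0 (2 * ratio_bound CARD('n) \<sigma>) \<subseteq> difference_body (truncated_simplex \<sigma>)"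
proof
  let ?d = "real CARD('n)" and ?B = "2 * steinhagen_constant CARD('n)"
  fix x :: "real ^ 'n" assume "x \<in> cball 0 (2 * ratio_bound CARD('n) \<sigma>)"
  then have x: "norm x \<le> ?B" "norm x \<le> \<sigma> + 1" by (auto simp: ratio_bound_eq min_def split: if_splits)
  have "0 < ?B" using steinhagen_constant_ge_1[of "CARD('n)"] by simp
  have part: "(\<Sum>i\<in>UNIV. max 0 (u i \<bullet> y)) \<le> ?d + 1" if "norm y \<le> ?B" for y
  proof -
    have "(\<Sum>i\<in>UNIV. max 0 (u i \<bullet> y)) * ?B \<le> norm y * (?d + 1)" by (rule sum_pos_part_le)
    also have "\<dots> \<le> ?B * (?d + 1)" using that by (intro mult_right_mono) auto
    finally have "(\<Sum>i\<in>UNIV. max 0 (u i \<bullet> y)) * ?B \<le> (?d + 1) * ?B" by (simp only: mult.commute)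
    then show ?thesis using \<open>0 < ?B\<close> by simp
  qed
  let ?l = "\<lambda>i. max 0 (u i \<bullet> x) - \<sigma>" and ?h = "\<lambda>i. 1 - max 0 (u i \<bullet> (- x))"
  have "\<exists>t. (\<forall>i. ?l i \<le> t i \<and> t i \<le> ?h i) \<and> sum t UNIV = 0"
  proof (rule ex_between_sum)
    show "?l i \<le> ?h i" for i
      using inner_simplex_normal_le[of i x] x(2) \<sigma> by (auto simp: max_def)
    have "?d + 1 \<le> (?d + 1) * \<sigma>" using \<sigma> by simp
    then show "sum ?l UNIV \<le> 0"
      using part[OF x(1)] by (simp add: sum_subtractf card_UNIV_option algebra_simps)
    show "0 \<le> sum ?h UNIV"
      using part[of "- x"] x(1) by (simp add: sum_subtractf card_UNIV_option)
  qed
  then obtain t where t: "\<And>i. ?l i \<le> t i" "\<And>i. t i \<le> ?h i" "sum t UNIV = 0" by blast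
  obtain k where k: "\<And>i. u i \<bullet> k = t i" using ex_simplex_coordinates[OF t(3)] by blast
  have b: "- \<sigma> \<le> t i \<and> t i \<le> 1 \<and> - \<sigma> \<le> t i - u i \<bullet> x \<and> t i - u i \<bullet> x \<le> 1" for i
    using t(1)[of i] t(2)[of i] by (auto simp: max_def split: if_splits)
  then have "k \<in> truncated_simplex \<sigma>" "k - x \<in> truncated_simplex \<sigma>"
    by (auto simp: truncated_simplex_def k inner_diff_right)
  moreover have "x = k - (k - x)" by simp
  ultimately show "x \<in> difference_body (truncated_simplex \<sigma>)"
    unfolding difference_body_def by blast
qed

text \<open>The half width need not be computed: the ball in the difference body bounds it from below, and the
  general inequality bounds it from above.\<close>

lemma ratio_truncated_simplex:
  assumes \<sigma>: "1 \<le> \<sigma>" "\<sigma> \<le> real CARD('n)"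
  shows "ratio (half_width (truncated_simplex \<sigma>)) (inradius (truncated_simplex \<sigma>))
       = ratio_bound CARD('n) (minkowski_asymmetry (truncated_simplex \<sigma>))"
proof (rule antisym)
  let ?K = "truncated_simplex \<sigma>"
  have body: "convex_body ?K"
    using \<sigma>(1) by (intro convex_body_truncated_simplex) simp
  have "\<nexists>p. ?K = {p}"
    using minkowski_asymmetry_truncated_simplex[OF \<sigma>] \<sigma>(1)
    by (auto simp: minkowski_asymmetry_singleton)
  then show "ratio (half_width ?K) (inradius ?K) \<le> ratio_bound CARD('n) (minkowski_asymmetry ?K)"
    using ratio_le_ratio_bound[OF body] by simp
  have "0 \<le> ratio_bound CARD('n) \<sigma>"
    using \<sigma>(1) by (simp add: ratio_bound_eq steinhagen_constant_def)
  from half_width_ge[OF body this cball_subset_difference_truncated_simplex[OF \<sigma>(1)]]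
  show "ratio_bound CARD('n) (minkowski_asymmetry ?K) \<le> ratio (half_width ?K) (inradius ?K)"
    by (simp add: minkowski_asymmetry_truncated_simplex[OF \<sigma>] inradius_truncated_simplex[OF \<sigma>(1)] ratio_def)
qed

end

theorem theorem5p2:
  shows "(\<forall>K :: (real ^ 'n) set. convex_body K \<and> (\<nexists>p. K = {p}) \<longrightarrow>
            ratio (half_width K) (inradius K) \<le> ratio_bound CARD('n) (minkowski_asymmetry K)) \<and>
         (\<forall>\<sigma>::real. 1 \<le> \<sigma> \<and> \<sigma> \<le> real CARD('n) \<longrightarrow>
            (\<exists>K :: (real ^ 'n) set. convex_body K \<and> minkowski_asymmetry K = \<sigma> \<and>
               ratio (half_width K) (inradius K) = ratio_bound CARD('n) (minkowski_asymmetry K)))"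
proof (intro conjI allI impI)
  fix K :: "(real ^ 'n) set" assume "convex_body K \<and> (\<nexists>p. K = {p})"
  then show "ratio (half_width K) (inradius K) \<le> ratio_bound CARD('n) (minkowski_asymmetry K)"
    using ratio_le_ratio_bound by blast
next
  fix \<sigma> :: real assume \<sigma>: "1 \<le> \<sigma> \<and> \<sigma> \<le> real CARD('n)"
  obtain u :: "'n option \<Rightarrow> real ^ 'n" where u: "simplex_normals u"
    using ex_simplex_normals by blast
  show "\<exists>K :: (real ^ 'n) set. convex_body K \<and> minkowski_asymmetry K = \<sigma> \<and>
               ratio (half_width K) (inradius K) = ratio_bound CARD('n) (minkowski_asymmetry K)"
    using \<sigma> convex_body_truncated_simplex[OF u, of \<sigma>] minkowski_asymmetry_truncated_simplex[OF u, of \<sigma>]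
      ratio_truncated_simplex[OF u, of \<sigma>] by (intro exI[of _ "truncated_simplex u \<sigma>"]) simp
qed

end
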